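(* 1) For all $z,\lambda\in\mathbb{C}^*$ (and every $x\in\mathbb{C}^*$ with $x^3=\frac1{z^2}$), the map $\psi_3(z,\lambda;x):WB_3\to GL_3(\mathbb{C})$ is a representation of $WB_3$ which is an extension of the specialization $\tau_3(z)$ of the standard representation of the braid group $B_3$. If $z\neq 1$, then $\psi_3(z,\lambda;x)$ is irreducible. 2) For all $z_1,z_2,\lambda_1,\lambda_2\in\mathbb{C}^*$ (and all $x_1,x_2$ with $x_i^3=\frac{1}{z_i^2}$): (a) if $z_1\neq z_2$, then $\psi_3(z_1,\lambda_1;x_1)$ and $\psi_3(z_2,\lambda_2;x_2)$ are not equivalent; (b) if $z_1=z_2=z\neq 1$ and $(\lambda_1,x_1)\neq(\lambda_2,x_2)$, then $\psi_3(z,\lambda_1;x_1)$ and $\psi_3(z,\lambda_2;x_2)$ are not equivalent. 3) For all $z_1,z_2,\lambda_1,\lambda_2\in\mathbb{C}^*$ (and $x_1$ with $x_1^3=\frac{1}{z_1^2}$): (a) if $z_1\neq z_2$, then $\psi_3(z_1,\lambda_1;x_1)$ and $\widetilde{\tau}_3(z_2,\lambda_2)$ are not equivalent; (b) if $z_1=z_2=z\neq 1$ and $\lambda_1\neq 1$, then $\psi_3(z,\lambda_1;x_1)$ and $\widetilde{\tau}_3(z,\lambda_2)$ are not equivalent; for $\lambda_1=1$ the representation $\psi_3(z,1;x)$ is equal to $\widetilde{\tau}_3(z,x)$.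
   Context: The welded braid group $WB_3$ is generated by $\alpha_1,\alpha_2,\sigma_1,\sigma_2$ with defining relations $\alpha_1^2=\alpha_2^2=1$, $\alpha_1\alpha_2\alpha_1=\alpha_2\alpha_1\alpha_2$, $\sigma_1\sigma_2\sigma_1=\sigma_2\sigma_1\sigma_2$, $\alpha_1\alpha_2\sigma_1=\sigma_2\alpha_1\alpha_2$, $\sigma_1\sigma_2\alpha_1=\alpha_2\sigma_1\sigma_2$. The subgroup generated by $\sigma_1,\sigma_2$ is isomorphic to the braid group on 3 strings and is denoted $B_3$. For $z\in\mathbb{C}^*$, $\tau_3(z):B_3\to GL_3(\mathbb{C})$ is $$\tau_3(z)(\sigma_1)=\begin{pmatrix}0&z&0\\1&0&0\\0&0&1\end{pmatrix},\quad \tau_3(z)(\sigma_2)=\begin{pmatrix}1&0&0\\0&0&z\\0&1&0\end{pmatrix}.$$ For $z,\lambda\in\mathbb{C}^*$, $\widetilde{\tau}_3(z,\lambda):WB_3\to GL_3(\mathbb{C})$ is the representation with $\widetilde{\tau}_3(z,\lambda)(\sigma_i)=\tau_3(z)(\sigma_i)$ and $$\widetilde{\tau}_3(z,\lambda)(\alpha_1)=\begin{pmatrix}0&\frac1\lambda&0\\ \lambda&0&0\\0&0&1\end{pmatrix},\quad \widetilde{\tau}_3(z,\lambda)(\alpha_2)=\begin{pmatrix}1&0&0\\0&0&\frac1\lambda\\0&\lambda&0\end{pmatrix}.$$ For $z,\lambda\in\mathbb{C}^*$ and $x$ with $x^3=\frac1{z^2}$, the map $\psi_3(z,\lambda;x)$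 is defined on generators by $\psi_3(z,\lambda;x)(\sigma_i)=$ the matrix $\tau_3(z)(\sigma_i)$ above and $$\psi_3(z,\lambda;x)(\alpha_1)=\begin{pmatrix}a&\frac bx&\frac c{x^2}\\ xb&c&\frac ax\\ x^2c&xa&b\end{pmatrix},\quad \psi_3(z,\lambda;x)(\alpha_2)=\begin{pmatrix}b&\frac cx&\frac a{x^2}\\ xc&a&\frac bx\\ x^2a&xb&c\end{pmatrix},$$ where, with $\omega$ the primitive cubic root of unity, $a=\frac{\omega}{3}\lambda+\frac13+\frac{\omega^2}{3}\lambda^{-1}$, $b=\frac13\lambda+\frac13+\frac13\lambda^{-1}$, $c=\frac{\omega^2}{3}\lambda+\frac13+\frac{\omega}{3}\lambda^{-1}$. *)

theory Defs
  imports "HOL-Analysis.Analysis" "HOL-Algebra.Generated_Groups"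
begin

section \<open>Groups given by generators and relations\<close>

text \<open>A word is a list of letters; \<open>(g, True)\<close> stands for the generator \<open>g\<close> and
  \<open>(g, False)\<close> for its formal inverse. A relation \<open>u = v\<close> is the pair \<open>(u, v)\<close>.\<close>

type_synonym 'g word = "('g \<times> bool) list"

definition pos_word :: "'g list \<Rightarrow> 'g word" where
  "pos_word gs = map (\<lambda>g. (g, True)) gs"

inductive word_cong :: "('g word \<times> 'g word) set \<Rightarrow> 'g word \<Rightarrow> 'g word \<Rightarrow> bool"
  for R where
  relation: "(u, v) \<in> R \<Longrightarrow> word_cong R u v"
| cancel: "word_cong R [(g, b), (g, \<not> b)] []"
| in_context: "word_cong R u v \<Longrightarrow> word_cong R (x @ u @ y) (x @ v @ y)"
| refl: "word_cong R u u"
| sym: "word_cong R u v \<Longrightarrow> word_cong R v u"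
| trans: "word_cong R u v \<Longrightarrow> word_cong R v w \<Longrightarrow> word_cong R u w"

definition word_class :: "('g word \<times> 'g word) set \<Rightarrow> 'g word \<Rightarrow> 'g word set" where
  "word_class R u = {v. word_cong R u v}"

definition presented_group :: "('g word \<times> 'g word) set \<Rightarrow> 'g word set monoid" where
  "presented_group R =
    \<lparr>carrier = range (word_class R),
     mult = (\<lambda>A B. {w. \<exists>u\<in>A. \<exists>v\<in>B. word_cong R (u @ v) w}),
     one = word_class R []\<rparr>"

fun word_eval :: "('a, 'b) monoid_scheme \<Rightarrow> ('g \<Rightarrow> 'a) \<Rightarrow> 'g word \<Rightarrow> 'a" where
  "word_eval G f [] = \<one>\<^bsub>G\<^esub>"
| "word_eval G f ((g, b) # w) =
     (if b then f g else inv\<^bsub>G\<^esub> f g) \<otimes>\<^bsub>G\<^esub> word_eval G f w"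

text \<open>The map, given by \<open>f\<close> on the generators in \<open>S\<close>, on the subgroup generated by \<open>S\<close> of a
  presented group: evaluate any word in the letters of \<open>S\<close> that represents the element. It is
  independent of the chosen word only if \<open>f\<close> is compatible with the relations.\<close>

definition map_by_gens ::
    "('a, 'b) monoid_scheme \<Rightarrow> 'g set \<Rightarrow> ('g \<Rightarrow> 'a) \<Rightarrow> 'g word set \<Rightarrow> 'a" where
  "map_by_gens G S f C = word_eval G f (SOME w. w \<in> C \<and> fst ` set w \<subseteq> S)"

lemma word_class_eq_iff: "word_class R u = word_class R v \<longleftrightarrow> word_cong R u v"
  unfolding word_class_def
  using word_cong.refl word_cong.sym word_cong.trans by (metis (mono_tags) mem_Collect_eq Collect_cong)

lemma mem_word_class: "v \<in> word_class R u \<longleftrightarrow> word_cong R u v"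
  by (simp add: word_class_def)

lemma word_cong_append:
  assumes "word_cong R u u'" "word_cong R v v'"
  shows "word_cong R (u @ v) (u' @ v')"
proof -
  have "word_cong R (u @ v) (u' @ v)"
    using word_cong.in_context[OF assms(1), of "[]" v] by simp
  moreover have "word_cong R (u' @ v) (u' @ v')"
    using word_cong.in_context[OF assms(2), of u' "[]"] by simp
  ultimately show ?thesis by (rule word_cong.trans)
qed

lemma presented_group_mult:
  "word_class R u \<otimes>\<^bsub>presented_group R\<^esub> word_class R v = word_class R (u @ v)"
proof -
  have "(\<exists>u'\<in>word_class R u. \<exists>v'\<in>word_class R v. word_cong R (u' @ v') w)
      \<longleftrightarrow> word_cong R (u @ v) w" for w
    unfolding mem_word_class Bex_def
    using word_cong_append word_cong.refl word_cong.trans by metis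
  then show ?thesis by (simp add: presented_group_def word_class_def)
qed

lemma presented_group_carrier: "carrier (presented_group R) = range (word_class R)"
  by (simp add: presented_group_def)

lemma presented_group_one: "\<one>\<^bsub>presented_group R\<^esub> = word_class R []"
  by (simp add: presented_group_def)

definition inv_word :: "'g word \<Rightarrow> 'g word" where
  "inv_word w = rev (map (\<lambda>(g, b). (g, \<not> b)) w)"

lemma inv_word_cong: "word_cong R (inv_word w @ w) []"
proof (induction w)
  case Nil
  then show ?case by (simp add: inv_word_def word_cong.refl)
next
  case (Cons a w)
  obtain g b where a: "a = (g, b)" by (cases a)
  have "word_cong R (inv_word w @ [(g, \<not> b), (g, \<not> \<not> b)] @ w) (inv_word w @ [] @ w)"
    by (intro word_cong.in_context word_cong.cancel)
  then have "word_cong R (inv_word (a # w) @ a # w) (inv_word w @ w)"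
    by (simp add: inv_word_def a)
  then show ?case using Cons.IH word_cong.trans by blast
qed

lemma group_presented_group: "group (presented_group R)"
proof (rule groupI)
  fix x assume "x \<in> carrier (presented_group R)"
  then obtain w where "x = word_class R w" by (auto simp: presented_group_carrier)
  then show "\<exists>y\<in>carrier (presented_group R). y \<otimes>\<^bsub>presented_group R\<^esub> x = \<one>\<^bsub>presented_group R\<^esub>"
    using inv_word_cong[of R w]
    by (auto simp: presented_group_carrier presented_group_mult presented_group_one word_class_eq_iff
        intro!: exI[of _ "inv_word w"])
qed (auto simp: presented_group_carrier presented_group_mult presented_group_one)

lemma word_eval_closed:
  assumes "group G" "\<And>g. g \<in> fst ` set w \<Longrightarrow> f g \<in> carrier G"
  shows "word_eval G f w \<in> carrier G"
proof -
  interpret group G by fact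
  show ?thesis using assms(2) by (induction w) auto
qed

lemma word_eval_append:
  assumes "group G" "\<And>g. f g \<in> carrier G"
  shows "word_eval G f (u @ v) = word_eval G f u \<otimes>\<^bsub>G\<^esub> word_eval G f v"
proof -
  interpret group G by fact
  have "word_eval G f w \<in> carrier G" for w
    using assms by (simp add: word_eval_closed)
  then show ?thesis by (induction u) (auto simp: assms(2) m_assoc)
qed

lemma word_eval_cong:
  assumes "group G" "\<And>g. f g \<in> carrier G"
    and "\<And>u v. (u, v) \<in> R \<Longrightarrow> word_eval G f u = word_eval G f v"
    and "word_cong R u v"
  shows "word_eval G f u = word_eval G f v"
  using assms(4)
proof induction
  case (cancel g b)
  interpret group G by fact
  show ?case using assms(2) by (cases b) auto
qed (auto simp: assms(3) word_eval_append[OF assms(1,2)])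

lemma map_by_gens_class:
  assumes "group G" "\<And>g. f g \<in> carrier G"
    and "\<And>u v. (u, v) \<in> R \<Longrightarrow> word_eval G f u = word_eval G f v"
    and "fst ` set w \<subseteq> S"
  shows "map_by_gens G S f (word_class R w) = word_eval G f w"
proof -
  let ?w = "SOME w'. w' \<in> word_class R w \<and> fst ` set w' \<subseteq> S"
  have "?w \<in> word_class R w \<and> fst ` set ?w \<subseteq> S"
    by (rule someI[of _ w]) (simp add: assms(4) mem_word_class word_cong.refl)
  then have "word_cong R w ?w" by (simp add: mem_word_class)
  then show ?thesis
    unfolding map_by_gens_def using word_eval_cong[OF assms(1-3)] by metis
qed

lemma map_by_gens_hom:
  assumes "group G" "\<And>g. f g \<in> carrier G"
    and "\<And>u v. (u, v) \<in> R \<Longrightarrow> word_eval G f u = word_eval G f v"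
  shows "map_by_gens G UNIV f \<in> hom (presented_group R) G"
  by (rule homI)
     (auto simp: presented_group_carrier presented_group_mult map_by_gens_class[OF assms]
       word_eval_append[OF assms(1,2)] word_eval_closed assms(1,2))


section \<open>Complex representations\<close>

definition GL :: "(complex ^ 'n ^ 'n) monoid" where
  "GL = \<lparr>carrier = {A. invertible A}, mult = (**), one = mat 1\<rparr>"

lemma group_GL: "group GL"
proof (rule groupI)
  fix A :: "complex ^ 'n ^ 'n" assume "A \<in> carrier GL"
  then obtain B where "A ** B = mat 1" "B ** A = mat 1"
    by (auto simp: GL_def invertible_def)
  then show "\<exists>B\<in>carrier GL. B \<otimes>\<^bsub>GL\<^esub> A = \<one>\<^bsub>GL\<^esub>"
    by (auto simp: GL_def invertible_def)
qed (auto simp: GL_def invertible_mult matrix_mul_assoc invertible_def[of "mat 1"])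

definition is_rep :: "('a, 'b) monoid_scheme \<Rightarrow> ('a \<Rightarrow> complex ^ 'n ^ 'n) \<Rightarrow> bool" where
  "is_rep G \<rho> \<longleftrightarrow> \<rho> \<in> hom G GL"

text \<open>\<open>vec.subspace\<close> is the notion of a complex linear subspace here, \<open>subspace\<close> would be
  that of a real one.\<close>

definition irreducible_rep :: "('a, 'b) monoid_scheme \<Rightarrow> ('a \<Rightarrow> complex ^ 'n ^ 'n) \<Rightarrow> bool" where
  "irreducible_rep G \<rho> \<longleftrightarrow> is_rep G \<rho> \<and>
    (\<forall>W. vec.subspace W \<and> (\<forall>g\<in>carrier G. \<forall>v\<in>W. \<rho> g *v v \<in> W) \<longrightarrow> W = {0} \<or> W = UNIV)"

definition equivalent_reps ::
    "('a, 'b) monoid_scheme \<Rightarrow> ('a \<Rightarrow> complex ^ 'n ^ 'n) \<Rightarrow> ('a \<Rightarrow> complex ^ 'n ^ 'n) \<Rightarrow> bool" where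
  "equivalent_reps G \<rho> \<rho>' \<longleftrightarrow>
    (\<exists>P. invertible P \<and> (\<forall>g\<in>carrier G. \<rho>' g = P ** \<rho> g ** matrix_inv P))"


section \<open>The welded braid group on three strings\<close>

datatype wb_gen = Alpha1 | Alpha2 | Sigma1 | Sigma2

definition WB3_relations :: "(wb_gen word \<times> wb_gen word) set" where
  "WB3_relations = (\<lambda>(u, v). (pos_word u, pos_word v)) `
    {([Alpha1, Alpha1], []),
     ([Alpha2, Alpha2], []),
     ([Alpha1, Alpha2, Alpha1], [Alpha2, Alpha1, Alpha2]),
     ([Sigma1, Sigma2, Sigma1], [Sigma2, Sigma1, Sigma2]),
     ([Alpha1, Alpha2, Sigma1], [Sigma2, Alpha1, Alpha2]),
     ([Sigma1, Sigma2, Alpha1], [Alpha2, Sigma1, Sigma2])}"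

definition WB3 :: "wb_gen word set monoid" where
  "WB3 = presented_group WB3_relations"

definition wb_elem :: "wb_gen \<Rightarrow> wb_gen word set" where
  "wb_elem g = word_class WB3_relations [(g, True)]"

definition B3 :: "wb_gen word set set" where
  "B3 = generate WB3 {wb_elem Sigma1, wb_elem Sigma2}"


section \<open>The representations\<close>

abbreviation matrix3 :: "complex list list \<Rightarrow> complex ^ 3 ^ 3" where
  "matrix3 rs \<equiv> vector (map vector rs)"

text \<open>Only the values at \<open>Sigma1\<close> and \<open>Sigma2\<close> matter.\<close>

definition tau3_gen :: "complex \<Rightarrow> wb_gen \<Rightarrow> complex ^ 3 ^ 3" where
  "tau3_gen z g = (case g of
     Sigma1 \<Rightarrow> matrix3 [[0, z, 0], [1, 0, 0], [0, 0, 1]]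
   | Sigma2 \<Rightarrow> matrix3 [[1, 0, 0], [0, 0, z], [0, 1, 0]])"

text \<open>To be used on \<open>B3\<close> only.\<close>

definition tau3 :: "complex \<Rightarrow> wb_gen word set \<Rightarrow> complex ^ 3 ^ 3" where
  "tau3 z = map_by_gens GL {Sigma1, Sigma2} (tau3_gen z)"

definition tau3_tilde_gen :: "complex \<Rightarrow> complex \<Rightarrow> wb_gen \<Rightarrow> complex ^ 3 ^ 3" where
  "tau3_tilde_gen z l g = (case g of
     Alpha1 \<Rightarrow> matrix3 [[0, 1 / l, 0], [l, 0, 0], [0, 0, 1]]
   | Alpha2 \<Rightarrow> matrix3 [[1, 0, 0], [0, 0, 1 / l], [0, l, 0]]
   | Sigma1 \<Rightarrow> tau3_gen z Sigma1
   | Sigma2 \<Rightarrow> tau3_gen z Sigma2)"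

definition tau3_tilde :: "complex \<Rightarrow> complex \<Rightarrow> wb_gen word set \<Rightarrow> complex ^ 3 ^ 3" where
  "tau3_tilde z l = map_by_gens GL UNIV (tau3_tilde_gen z l)"

definition psi3_gen ::
    "complex \<Rightarrow> complex \<Rightarrow> complex \<Rightarrow> complex \<Rightarrow> wb_gen \<Rightarrow> complex ^ 3 ^ 3" where
  "psi3_gen \<omega> z l x g =
    (let a = \<omega> / 3 * l + 1 / 3 + \<omega>\<^sup>2 / 3 * inverse l;
         b = 1 / 3 * l + 1 / 3 + 1 / 3 * inverse l;
         c = \<omega>\<^sup>2 / 3 * l + 1 / 3 + \<omega> / 3 * inverse l
     in case g of
       Alpha1 \<Rightarrow> matrix3 [[a, b / x, c / x\<^sup>2], [x * b, c, a / x], [x\<^sup>2 * c, x * a, b]]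
     | Alpha2 \<Rightarrow> matrix3 [[b, c / x, a / x\<^sup>2], [x * c, a, b / x], [x\<^sup>2 * a, x * b, c]]
     | Sigma1 \<Rightarrow> tau3_gen z Sigma1
     | Sigma2 \<Rightarrow> tau3_gen z Sigma2)"

definition psi3 ::
    "complex \<Rightarrow> complex \<Rightarrow> complex \<Rightarrow> complex \<Rightarrow> wb_gen word set \<Rightarrow> complex ^ 3 ^ 3" where
  "psi3 \<omega> z l x = map_by_gens GL UNIV (psi3_gen \<omega> z l x)"

text \<open>\<open>tau3_tilde\<close> and \<open>tau3\<close> are well defined, with the prescribed values on generators.\<close>

lemma tau3_gen_invertible:
  assumes "z \<noteq> 0" "g \<in> {Sigma1, Sigma2}"
  shows "invertible (tau3_gen z g)"
  using assms by (auto simp: tau3_gen_def invertible_det_nz det_3)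

lemma tau3_tilde_gen_carrier:
  assumes "z \<noteq> 0" "l \<noteq> 0"
  shows "tau3_tilde_gen z l g \<in> carrier GL"
  using assms tau3_gen_invertible[OF assms(1)]
  by (cases g) (auto simp: tau3_tilde_gen_def GL_def invertible_det_nz det_3)

lemma tau3_tilde_gen_relations:
  assumes "z \<noteq> 0" "l \<noteq> 0" "(u, v) \<in> WB3_relations"
  shows "word_eval GL (tau3_tilde_gen z l) u = word_eval GL (tau3_tilde_gen z l) v"
  using assms
  by (auto simp: WB3_relations_def pos_word_def GL_def tau3_tilde_gen_def tau3_gen_def
      vec_eq_iff forall_3 matrix_matrix_mult_def sum_3 mat_def)

lemma tau3_tilde_is_rep:
  assumes "z \<noteq> 0" "l \<noteq> 0"
  shows "is_rep WB3 (tau3_tilde z l)"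
  unfolding is_rep_def WB3_def tau3_tilde_def
  by (intro map_by_gens_hom group_GL tau3_tilde_gen_carrier tau3_tilde_gen_relations assms)

lemma tau3_tilde_elem:
  assumes "z \<noteq> 0" "l \<noteq> 0"
  shows "tau3_tilde z l (wb_elem g) = tau3_tilde_gen z l g"
  using map_by_gens_class[OF group_GL tau3_tilde_gen_carrier tau3_tilde_gen_relations,
      OF assms assms, where w = "[(g, True)]" and S = UNIV]
  by (simp add: tau3_tilde_def wb_elem_def GL_def)

lemma B3_words:
  assumes "C \<in> B3"
  shows "\<exists>w. w \<in> C \<and> fst ` set w \<subseteq> {Sigma1, Sigma2} \<and> C = word_class WB3_relations w"
  using assms unfolding B3_def
proof induction
  case one
  then show ?case
    by (intro exI[of _ "[]"]) (simp add: WB3_def presented_group_one mem_word_class word_cong.refl)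
next
  case (incl h)
  then show ?case
    by (auto simp: wb_elem_def mem_word_class word_cong.refl
        intro: exI[of _ "[(Sigma1, True)]"] exI[of _ "[(Sigma2, True)]"])
next
  case (inv h)
  then obtain g where g: "h = wb_elem g" "g \<in> {Sigma1, Sigma2}" by auto
  have "word_class WB3_relations [(g, False)] \<otimes>\<^bsub>WB3\<^esub> h = \<one>\<^bsub>WB3\<^esub>"
    using word_cong.cancel[of WB3_relations g False]
    by (simp add: g wb_elem_def WB3_def presented_group_mult presented_group_one word_class_eq_iff)
  then have "inv\<^bsub>WB3\<^esub> h = word_class WB3_relations [(g, False)]"
    by (intro group.inv_equality) (auto simp: WB3_def group_presented_group
        presented_group_carrier g wb_elem_def)
  then show ?case
    using g by (auto simp: mem_word_class word_cong.refl intro!: exI[of _ "[(g, False)]"])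
next
  case (eng h1 h2)
  then obtain w1 w2 where
    "fst ` set w1 \<subseteq> {Sigma1, Sigma2}" "h1 = word_class WB3_relations w1"
    "fst ` set w2 \<subseteq> {Sigma1, Sigma2}" "h2 = word_class WB3_relations w2" by blast
  then show ?case
    by (intro exI[of _ "w1 @ w2"])
       (auto simp: WB3_def presented_group_mult mem_word_class word_cong.refl)
qed

lemma tau3_eq_tau3_tilde:
  assumes "z \<noteq> 0" "l \<noteq> 0" "C \<in> B3"
  shows "tau3 z C = tau3_tilde z l C"
proof -
  obtain w where w: "w \<in> C" "fst ` set w \<subseteq> {Sigma1, Sigma2}" and C: "C = word_class WB3_relations w"
    using B3_words[OF assms(3)] by blast
  define u where "u = (SOME w. w \<in> C \<and> fst ` set w \<subseteq> {Sigma1, Sigma2})"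
  have u: "u \<in> C \<and> fst ` set u \<subseteq> {Sigma1, Sigma2}"
    unfolding u_def by (rule someI[of _ w]) (use w in simp)
  have "word_eval GL (tau3_gen z) v = word_eval GL (tau3_tilde_gen z l) v"
    if "fst ` set v \<subseteq> {Sigma1, Sigma2}" for v
    using that by (induction v) (auto simp: tau3_tilde_gen_def)
  then have "tau3 z C = word_eval GL (tau3_tilde_gen z l) u"
    using u by (simp add: tau3_def map_by_gens_def u_def)
  moreover have "C = word_class WB3_relations u"
    using u C word_class_eq_iff mem_word_class by metis
  ultimately show ?thesis
    using map_by_gens_class[OF group_GL tau3_tilde_gen_carrier tau3_tilde_gen_relations,
        OF assms(1,2) assms(1,2), where w = u and S = UNIV]
    by (simp add: tau3_tilde_def)
qed

end

theory Submission
  imports Defs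
begin

text \<open>
  On the cyclic group of order three, the function with values \<open>b, a, c\<close> has Fourier transform
  \<open>(1, l, 1/l)\<close>. The first value says \<open>a + b + c = 1\<close>; that the other two have product \<open>1\<close> says
  \<open>a\<^sup>2 + b\<^sup>2 + c\<^sup>2 - (ab + bc + ca) = 1\<close>, and together this means \<open>ab + bc + ca = 0\<close>. These two equations are
  all that the relations of the welded braid group ask for (\<open>psi3_gen_relations\<close>). Up to
  conjugation by \<open>diag(1, x, x\<^sup>2)\<close>, the rows of the image of each \<open>\<alpha>\<^sub>i\<close> are the three cyclic shifts of
  \<open>(a, b, c)\<close>, in an order that makes the matrix symmetric. The equations say that these rows
  are orthonormal for the standard bilinear form, so both images are involutions, and their
  product is a cyclic permutation matrix. The condition \<open>x\<^sup>3 = 1/z\<^sup>2\<close> makes that product equal to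
  \<open>x \<sigma>\<^sub>1 \<sigma>\<^sub>2\<close>. Now \<open>\<sigma>\<^sub>1 \<sigma>\<^sub>2\<close> carries \<open>\<sigma>\<^sub>1\<close> to \<open>\<sigma>\<^sub>2\<close> under conjugation, by the braid relation, and
  it carries \<open>\<alpha>\<^sub>1\<close> to \<open>\<alpha>\<^sub>2\<close>, because it shifts the coefficients; hence so does \<open>\<alpha>\<^sub>1 \<alpha>\<^sub>2\<close>. These
  are the remaining relations.

  Irreducibility and the comparison of representations rest on the braid generators. The squares
  of \<open>\<sigma>\<^sub>1, \<sigma>\<^sub>2\<close> are \<open>diag(z, z, 1)\<close> and \<open>diag(1, z, z)\<close>. For \<open>z \<noteq> 1\<close> they separate the coordinates,
  so an invariant subspace is trivial (\<open>tau3_invariant_subspace\<close>) and a matrix that commutes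
  with both \<open>\<sigma>\<^sub>i\<close> is scalar (\<open>tau3_commutant\<close>). Hence two equivalent representations that extend
  the same \<open>\<tau>\<^sub>3(z)\<close> are equal (\<open>equivalent_reps_tau3_eq\<close>). Equality of the images of
  \<open>\<alpha>\<^sub>1, \<alpha>\<^sub>2\<close> determines \<open>l\<close>, by the Fourier transform, and then \<open>x\<close>; and the monomial
  matrices by which the second family extends \<open>\<tau>\<^sub>3(z)\<close> arise only for \<open>b = 1\<close> and \<open>a = c = 0\<close>, that
  is, for \<open>l = 1\<close>. Different values of
  \<open>z\<close> are told apart by the determinant \<open>-z\<close> of \<open>\<sigma>\<^sub>1\<close>.
\<close>

section \<open>The coefficients\<close>

text \<open>The coefficients \<open>a, b, c\<close> are the values at the cube roots of unity \<open>\<zeta> = \<omega>, 1, \<omega>\<^sup>2\<close>.\<close>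

definition psi3_coeff :: "complex \<Rightarrow> complex \<Rightarrow> complex" where
  "psi3_coeff \<zeta> l = (\<zeta> * l + 1 + \<zeta>\<^sup>2 * inverse l) / 3"

lemma primitive_cube_root_sum:
  fixes \<omega> :: complex
  assumes "\<omega> ^ 3 = 1" "\<omega> \<noteq> 1"
  shows "\<omega>\<^sup>2 + \<omega> + 1 = 0"
proof -
  have "(\<omega> - 1) * (\<omega>\<^sup>2 + \<omega> + 1) = 0"
    using assms(1) by (simp add: algebra_simps power2_eq_square power3_eq_cube)
  then show ?thesis using assms(2) by simp
qed

lemma psi3_coeff_scaled:
  assumes "\<omega> ^ 3 = 1"
  shows "3 * psi3_coeff \<omega> l = \<omega> * l + 1 + \<omega>\<^sup>2 * inverse l"
    and "3 * psi3_coeff 1 l = l + 1 + inverse l"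
    and "3 * psi3_coeff (\<omega>\<^sup>2) l = \<omega>\<^sup>2 * l + 1 + \<omega> * inverse l"
proof -
  have "(\<omega>\<^sup>2)\<^sup>2 = \<omega>" using assms by algebra
  then show "3 * psi3_coeff \<omega> l = \<omega> * l + 1 + \<omega>\<^sup>2 * inverse l"
    "3 * psi3_coeff 1 l = l + 1 + inverse l"
    "3 * psi3_coeff (\<omega>\<^sup>2) l = \<omega>\<^sup>2 * l + 1 + \<omega> * inverse l"
    by (simp_all add: psi3_coeff_def)
qed

text \<open>The value of the Fourier transform at the trivial character.\<close>

lemma psi3_coeff_sum:
  assumes "\<omega> ^ 3 = 1" "\<omega> \<noteq> 1"
  shows "psi3_coeff \<omega> l + psi3_coeff 1 l + psi3_coeff (\<omega>\<^sup>2) l = 1"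
proof -
  note w = primitive_cube_root_sum[OF assms]
  \<comment> \<open>An opaque name for the inverse makes the identity a polynomial one.\<close>
  obtain m where m: "m = inverse l" by blast
  have "3 * (psi3_coeff \<omega> l + psi3_coeff 1 l + psi3_coeff (\<omega>\<^sup>2) l) = 3 * 1"
    using w psi3_coeff_scaled[OF assms(1), of l, folded m] by algebra
  then show ?thesis by (simp only: mult_cancel_left, simp)
qed

text \<open>The values at the two other characters are \<open>l\<close> and \<open>1/l\<close>. Their product, expanded in the
  coefficients, is the sum of the squares minus the sum of the products of pairs; the square of the
  value at the trivial character is the sum of the squares plus twice that sum. Both are \<open>1\<close>.\<close>

lemma psi3_coeff_products:
  assumes "\<omega> ^ 3 = 1" "\<omega> \<noteq> 1" "l \<noteq> 0"
  shows "psi3_coeff \<omega> l * psi3_coeff 1 l + psi3_coeff 1 l * psi3_coeff (\<omega>\<^sup>2) l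
    + psi3_coeff (\<omega>\<^sup>2) l * psi3_coeff \<omega> l = 0"
proof -
  note w = primitive_cube_root_sum[OF assms(1,2)]
  obtain m where m: "m = inverse l" by blast
  have l: "l * m = 1" using assms(3) by (simp add: m)
  have "9 * (psi3_coeff \<omega> l * psi3_coeff 1 l + psi3_coeff 1 l * psi3_coeff (\<omega>\<^sup>2) l
    + psi3_coeff (\<omega>\<^sup>2) l * psi3_coeff \<omega> l) = 9 * 0"
    using w l psi3_coeff_scaled[OF assms(1), of l, folded m] by algebra
  then show ?thesis by (simp only: mult_cancel_left, simp)
qed

text \<open>The value of the Fourier transform at a nontrivial character; so the coefficients
  determine \<open>l\<close>.\<close>

lemma psi3_coeff_recover:
  assumes "\<omega> ^ 3 = 1" "\<omega> \<noteq> 1"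
  shows "psi3_coeff 1 l + \<omega>\<^sup>2 * psi3_coeff \<omega> l + \<omega> * psi3_coeff (\<omega>\<^sup>2) l = l"
proof -
  note w = primitive_cube_root_sum[OF assms]
  obtain m where m: "m = inverse l" by blast
  have "3 * (psi3_coeff 1 l + \<omega>\<^sup>2 * psi3_coeff \<omega> l + \<omega> * psi3_coeff (\<omega>\<^sup>2) l) = 3 * l"
    using w psi3_coeff_scaled[OF assms(1), of l, folded m] by algebra
  then show ?thesis by (simp only: mult_cancel_left, simp)
qed

section \<open>The relations of the welded braid group\<close>

text \<open>The Hankel matrix with entries \<open>a, b, c, a, b\<close> on its antidiagonals, conjugated by
  \<open>diag(1, x, x\<^sup>2)\<close>. The coefficients are arguments because the image of \<open>\<alpha>\<^sub>2\<close> differs from that of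
  \<open>\<alpha>\<^sub>1\<close> only by a cyclic shift of them.\<close>

definition psi3_alpha :: "complex \<Rightarrow> complex \<Rightarrow> complex \<Rightarrow> complex \<Rightarrow> complex ^ 3 ^ 3" where
  "psi3_alpha x a b c =
    matrix3 [[a, b / x, c / x\<^sup>2], [x * b, c, a / x], [x\<^sup>2 * c, x * a, b]]"

lemma psi3_gen_Alpha:
  assumes "\<omega> ^ 3 = 1"
  shows "psi3_gen \<omega> z l x Alpha1
      = psi3_alpha x (psi3_coeff \<omega> l) (psi3_coeff 1 l) (psi3_coeff (\<omega>\<^sup>2) l)"
    and "psi3_gen \<omega> z l x Alpha2
      = psi3_alpha x (psi3_coeff 1 l) (psi3_coeff (\<omega>\<^sup>2) l) (psi3_coeff \<omega> l)"
proof -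
  have "(\<omega>\<^sup>2)\<^sup>2 = \<omega>" using assms by algebra
  then have "\<omega> / 3 * l + 1 / 3 + \<omega>\<^sup>2 / 3 * inverse l = psi3_coeff \<omega> l"
    "1 / 3 * l + 1 / 3 + 1 / 3 * inverse l = psi3_coeff 1 l"
    "\<omega>\<^sup>2 / 3 * l + 1 / 3 + \<omega> / 3 * inverse l = psi3_coeff (\<omega>\<^sup>2) l"
    by (simp_all add: psi3_coeff_def add_divide_distrib)
  then show "psi3_gen \<omega> z l x Alpha1
      = psi3_alpha x (psi3_coeff \<omega> l) (psi3_coeff 1 l) (psi3_coeff (\<omega>\<^sup>2) l)"
    "psi3_gen \<omega> z l x Alpha2
      = psi3_alpha x (psi3_coeff 1 l) (psi3_coeff (\<omega>\<^sup>2) l) (psi3_coeff \<omega> l)"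
    by (simp_all only: psi3_gen_def Let_def psi3_alpha_def wb_gen.case)
qed

lemma psi3_gen_Sigma [simp]:
  "psi3_gen \<omega> z l x Sigma1 = tau3_gen z Sigma1"
  "psi3_gen \<omega> z l x Sigma2 = tau3_gen z Sigma2"
  by (simp_all add: psi3_gen_def Let_def)

text \<open>With a name for \<open>1/x\<close> all entries are polynomials, so that equations between products of
  such matrices fall to Groebner basis methods.\<close>

lemma psi3_alpha_polynomial:
  assumes "x * y = 1"
  shows "psi3_alpha x a b c
    = matrix3 [[a, y * b, y\<^sup>2 * c], [x * b, c, y * a], [x\<^sup>2 * c, x * a, b]]"
proof -
  have "x \<noteq> 0" using assms by auto
  then have "y = 1 / x" using assms by (simp add: eq_divide_eq mult.commute)
  then show ?thesis by (simp add: psi3_alpha_def power_one_over)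
qed

text \<open>The two equations say that \<open>(a, b, c)\<close> is orthogonal to its proper cyclic shifts, and they
  imply \<open>a\<^sup>2 + b\<^sup>2 + c\<^sup>2 = 1\<close>; a symmetric matrix with orthonormal rows is its own inverse.\<close>

lemma psi3_alpha_involution:
  assumes "x \<noteq> 0" "a + b + c = 1" "a * b + b * c + c * a = 0"
  shows "psi3_alpha x a b c ** psi3_alpha x a b c = mat 1"
proof -
  obtain y where xy: "x * y = 1" using assms(1) by (metis right_inverse)
  show ?thesis
    unfolding psi3_alpha_polynomial[OF xy] vec_eq_iff forall_3
    by (simp add: matrix_matrix_mult_def sum_3 mat_def)
      (intro conjI; (use xy assms(2,3) in algebra)?)
qed

text \<open>Both factors have the same rows up to order, so by orthonormality the product is a cyclic
  permutation matrix conjugated by \<open>diag(1, x, x\<^sup>2)\<close>. So is \<open>x \<sigma>\<^sub>1 \<sigma>\<^sub>2\<close>, as \<open>x z\<^sup>2 = 1/x\<^sup>2\<close>.\<close>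

lemma psi3_alpha_mult:
  assumes "z \<noteq> 0" "x ^ 3 = 1 / z\<^sup>2" "a + b + c = 1" "a * b + b * c + c * a = 0"
  shows "psi3_alpha x a b c ** psi3_alpha x b c a
    = mat x ** (tau3_gen z Sigma1 ** tau3_gen z Sigma2)"
proof -
  have "x \<noteq> 0" using assms(1,2) by auto
  then obtain y where xy: "x * y = 1" by (metis right_inverse)
  have xz: "x ^ 3 * z\<^sup>2 = 1" using assms(1,2) by simp
  show ?thesis
    unfolding psi3_alpha_polynomial[OF xy] vec_eq_iff forall_3
    by (simp add: matrix_matrix_mult_def sum_3 mat_def tau3_gen_def)
      (intro conjI; (use xy xz assms(3,4) in algebra)?)
qed

text \<open>Up to the factor \<open>x\<close> and the conjugation by \<open>diag(1, x, x\<^sup>2)\<close>, the product \<open>\<sigma>\<^sub>1 \<sigma>\<^sub>2\<close> is a cyclic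
  permutation matrix; it permutes the rows on the left side and the columns on the right.\<close>

lemma psi3_alpha_shift:
  assumes "z \<noteq> 0" "x ^ 3 = 1 / z\<^sup>2"
  shows "tau3_gen z Sigma1 ** tau3_gen z Sigma2 ** psi3_alpha x a b c
    = psi3_alpha x b c a ** (tau3_gen z Sigma1 ** tau3_gen z Sigma2)"
proof -
  have "x \<noteq> 0" using assms(1,2) by auto
  then obtain y where xy: "x * y = 1" by (metis right_inverse)
  have xz: "x ^ 3 * z\<^sup>2 = 1" using assms(1,2) by simp
  show ?thesis
    unfolding psi3_alpha_polynomial[OF xy] vec_eq_iff forall_3
    by (simp add: matrix_matrix_mult_def sum_3 mat_def tau3_gen_def)
      (intro conjI; (use xy xz in algebra)?)
qed

lemma tau3_gen_braid:
  "tau3_gen z Sigma1 ** tau3_gen z Sigma2 ** tau3_gen z Sigma1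
    = tau3_gen z Sigma2 ** (tau3_gen z Sigma1 ** tau3_gen z Sigma2)"
  by (simp add: vec_eq_iff forall_3 matrix_matrix_mult_def sum_3 tau3_gen_def)

lemma mat_mult_commute: "mat c ** A = A ** mat c" for A :: "'a::comm_semiring_1 ^ 'n ^ 'n"
proof -
  have "(if b then c else 0) * u = (if b then c * u else 0)"
    "u * (if b then c else 0) = (if b then c * u else 0)" for b and u :: 'a
    by (simp_all add: mult.commute)
  then show ?thesis
    by (simp add: matrix_matrix_mult_def mat_def vec_eq_iff)
qed

lemma psi3_gen_carrier:
  assumes "\<omega> ^ 3 = 1" "\<omega> \<noteq> 1" "z \<noteq> 0" "l \<noteq> 0" "x \<noteq> 0"
  shows "psi3_gen \<omega> z l x g \<in> carrier GL"
proof -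
  have "invertible A" if "A ** A = mat 1" for A :: "complex ^ 3 ^ 3"
    using that invertible_def by blast
  note inv = this[OF psi3_alpha_involution[OF assms(5)]]
  have "invertible (psi3_gen \<omega> z l x g)"
    using psi3_coeff_sum[OF assms(1,2), of l] psi3_coeff_products[OF assms(1,2,4)]
      tau3_gen_invertible[OF assms(3)]
    by (cases g) (auto simp: psi3_gen_Alpha[OF assms(1)] ac_simps intro!: inv)
  then show ?thesis by (simp add: GL_def)
qed

lemma psi3_gen_relations:
  assumes "\<omega> ^ 3 = 1" "\<omega> \<noteq> 1" "z \<noteq> 0" "l \<noteq> 0" "x ^ 3 = 1 / z\<^sup>2"
    and "(u, v) \<in> WB3_relations"
  shows "word_eval GL (psi3_gen \<omega> z l x) u = word_eval GL (psi3_gen \<omega> z l x) v"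
proof -
  have x: "x \<noteq> 0" using assms(3,5) by auto
  define A1 A2 S1 S2 where gens: "A1 = psi3_gen \<omega> z l x Alpha1" "A2 = psi3_gen \<omega> z l x Alpha2"
    "S1 = psi3_gen \<omega> z l x Sigma1" "S2 = psi3_gen \<omega> z l x Sigma2"
  note coeff = psi3_coeff_sum[OF assms(1,2), of l] psi3_coeff_products[OF assms(1,2,4)]
  note alpha = gens psi3_gen_Alpha[OF assms(1)] psi3_gen_Sigma
  have A1: "A1 ** A1 = mat 1" and A2: "A2 ** A2 = mat 1"
    using coeff by (auto simp: alpha ac_simps intro!: psi3_alpha_involution[OF x])
  have A12: "A1 ** A2 = mat x ** (S1 ** S2)"
    unfolding alpha by (rule psi3_alpha_mult[OF assms(3,5) coeff])
  have mixed: "S1 ** S2 ** A1 = A2 ** (S1 ** S2)"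
    unfolding alpha by (rule psi3_alpha_shift[OF assms(3,5)])
  have braid: "S1 ** S2 ** S1 = S2 ** (S1 ** S2)"
    unfolding alpha by (rule tau3_gen_braid)
  \<comment> \<open>As \<open>A1 ** A2\<close> is a multiple of \<open>S1 ** S2\<close>, relations for the latter hold for the former:
    \<open>braid\<close> yields \<open>A1 ** A2 ** S1 = S2 ** (A1 ** A2)\<close>, and \<open>mixed\<close> yields the braid relation of
    \<open>A1\<close> and \<open>A2\<close>.\<close>
  have pull: "A1 ** A2 ** A = B ** (A1 ** A2)" if "S1 ** S2 ** A = B ** (S1 ** S2)" for A B
  proof -
    have "A1 ** A2 ** A = mat x ** (S1 ** S2 ** A)"
      by (simp add: A12 matrix_mul_assoc)
    also have "\<dots> = B ** (A1 ** A2)"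
      by (simp add: that A12 matrix_mul_assoc mat_mult_commute[of x B])
    finally show ?thesis .
  qed
  from assms(6) show ?thesis
    using A1 A2 pull[OF mixed] pull[OF braid] mixed braid
    by (auto simp: WB3_relations_def pos_word_def GL_def gens matrix_mul_assoc)
qed

lemma psi3_class:
  assumes "\<omega> ^ 3 = 1" "\<omega> \<noteq> 1" "z \<noteq> 0" "l \<noteq> 0" "x ^ 3 = 1 / z\<^sup>2"
  shows "psi3 \<omega> z l x (word_class WB3_relations w) = word_eval GL (psi3_gen \<omega> z l x) w"
proof -
  have x: "x \<noteq> 0" using assms(3,5) by auto
  show ?thesis
    unfolding psi3_def
    by (rule map_by_gens_class[OF group_GL psi3_gen_carrier[OF assms(1-4) x]
          psi3_gen_relations[OF assms]]) simp_all
qed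

lemma psi3_is_rep:
  assumes "\<omega> ^ 3 = 1" "\<omega> \<noteq> 1" "z \<noteq> 0" "l \<noteq> 0" "x ^ 3 = 1 / z\<^sup>2"
  shows "is_rep WB3 (psi3 \<omega> z l x)"
proof -
  have x: "x \<noteq> 0" using assms(3,5) by auto
  show ?thesis
    unfolding is_rep_def WB3_def psi3_def
    by (rule map_by_gens_hom[OF group_GL psi3_gen_carrier[OF assms(1-4) x]
          psi3_gen_relations[OF assms]])
qed

lemma psi3_elem:
  assumes "\<omega> ^ 3 = 1" "\<omega> \<noteq> 1" "z \<noteq> 0" "l \<noteq> 0" "x ^ 3 = 1 / z\<^sup>2"
  shows "psi3 \<omega> z l x (wb_elem g) = psi3_gen \<omega> z l x g"
  by (simp add: wb_elem_def psi3_class[OF assms] GL_def)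

lemma psi3_extends_tau3:
  assumes "\<omega> ^ 3 = 1" "\<omega> \<noteq> 1" "z \<noteq> 0" "l \<noteq> 0" "x ^ 3 = 1 / z\<^sup>2" "h \<in> B3"
  shows "psi3 \<omega> z l x h = tau3 z h"
proof -
  obtain w where w: "fst ` set w \<subseteq> {Sigma1, Sigma2}" and h: "h = word_class WB3_relations w"
    using B3_words[OF assms(6)] by blast
  have "psi3 \<omega> z l x h = word_eval GL (psi3_gen \<omega> z l x) w"
    unfolding h by (rule psi3_class[OF assms(1-5)])
  \<comment> \<open>Both \<open>psi3\<close> and \<open>tau3\<close> are compared with an extension of \<open>tau3\<close> to the whole group; \<open>1\<close> is
    an arbitrary nonzero parameter.\<close>
  also have "\<dots> = word_eval GL (tau3_tilde_gen z 1) w"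
    using w by (induction w) (auto simp: tau3_tilde_gen_def)
  also have "\<dots> = tau3_tilde z 1 h"
    unfolding h tau3_tilde_def using assms(3)
    by (subst map_by_gens_class[OF group_GL tau3_tilde_gen_carrier tau3_tilde_gen_relations]) auto
  also have "\<dots> = tau3 z h"
    using tau3_eq_tau3_tilde[of z 1 h] assms(3,6) by simp
  finally show ?thesis .
qed

section \<open>Invariant subspaces and intertwiners of the braid generators\<close>

text \<open>The operator \<open>\<sigma>\<^sub>2\<^sup>2 - z\<close> is \<open>1 - z\<close> times the projection to the first coordinate, and the
  \<open>\<sigma>\<^sub>i\<close> move every coordinate there.\<close>

lemma tau3_invariant_subspace:
  assumes W: "vec.subspace W" and z: "z \<noteq> 0" "z \<noteq> 1"
    and S1: "\<And>v. v \<in> W \<Longrightarrow> tau3_gen z Sigma1 *v v \<in> W"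
    and S2: "\<And>v. v \<in> W \<Longrightarrow> tau3_gen z Sigma2 *v v \<in> W"
  shows "W = {0} \<or> W = UNIV"
proof (rule disjCI)
  assume "W \<noteq> UNIV"
  note mv = matrix_vector_mult_def sum_3 tau3_gen_def vec_eq_iff forall_3 axis_def
  have first: "axis 1 (v $ 1) \<in> W" if v: "v \<in> W" for v
  proof -
    have "(1 / (1 - z)) *s
      (tau3_gen z Sigma2 *v (tau3_gen z Sigma2 *v v) - z *s v) \<in> W"
      by (intro vec.subspace_scale vec.subspace_diff W S2 v)
    also have "tau3_gen z Sigma2 *v (tau3_gen z Sigma2 *v v) - z *s v
      = axis 1 ((1 - z) * v $ 1)"
      by (simp add: mv algebra_simps)
    also have "(1 / (1 - z)) *s axis 1 ((1 - z) * v $ 1) = (axis 1 (v $ 1) :: complex ^ 3)"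
      using z(2) by (simp add: mv)
    finally show ?thesis .
  qed
  have e1: "axis 1 1 \<in> W" if "axis 1 t \<in> W" "t \<noteq> 0" for t
  proof -
    have "(1 / t) *s axis 1 t \<in> W" by (intro vec.subspace_scale W that(1))
    also have "(1 / t) *s axis 1 t = (axis 1 1 :: complex ^ 3)"
      using that(2) by (simp add: mv)
    finally show ?thesis .
  qed
  have no_e1: "axis 1 1 \<notin> W"
  proof
    assume 1: "axis 1 1 \<in> W"
    have "tau3_gen z Sigma1 *v axis 1 1 = axis 2 1" "tau3_gen z Sigma2 *v axis 2 1 = axis 3 1"
      by (simp_all add: mv)
    then have 2: "axis 2 1 \<in> W" and 3: "axis 3 1 \<in> W"
      using S1[OF 1] S2[of "axis 2 1"] by auto
    have "v \<in> W" for v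
    proof -
      have "(v $ 1) *s axis 1 1 + (v $ 2) *s axis 2 1 + (v $ 3) *s axis 3 1 \<in> W"
        by (intro vec.subspace_add vec.subspace_scale W 1 2 3)
      also have "(v $ 1) *s axis 1 1 + (v $ 2) *s axis 2 1 + (v $ 3) *s axis 3 1 = v"
        by (simp add: mv)
      finally show ?thesis .
    qed
    then show False using \<open>W \<noteq> UNIV\<close> by auto
  qed
  have zero: "t = 0" if "axis 1 t \<in> W" for t
    using e1 no_e1 that by blast
  have "v = 0" if v: "v \<in> W" for v
  proof -
    have "(tau3_gen z Sigma1 *v v) $ 1 = z * v $ 2"
      "(tau3_gen z Sigma1 *v (tau3_gen z Sigma2 *v v)) $ 1 = z * (z * v $ 3)"
      by (simp_all add: mv)
    then have "axis 1 (v $ 1) \<in> W" "axis 1 (z * v $ 2) \<in> W" "axis 1 (z * (z * v $ 3)) \<in> W"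
      using first[OF v] first[OF S1[OF v]] first[OF S1[OF S2[OF v]]] by simp_all
    then have "v $ 1 = 0" "z * v $ 2 = 0" "z * (z * v $ 3) = 0"
      using zero by blast+
    then show ?thesis
      using z(1) by (simp add: vec_eq_iff forall_3)
  qed
  then show "W = {0}" using vec.subspace_0[OF W] by auto
qed

text \<open>A matrix that commutes with \<open>\<sigma>\<^sub>1\<close> has equal entries at (2, 3) and (1, 3), and the latter is
  also \<open>z\<close> times the former, so both vanish for \<open>z \<noteq> 1\<close>; likewise at (3, 1) and (3, 2).
  Commutation with \<open>\<sigma>\<^sub>2\<close> carries this over to (1, 2) and (2, 1), and each \<open>\<sigma>\<^sub>i\<close> equates two
  diagonal entries.\<close>

lemma tau3_commutant:
  assumes z: "z \<noteq> 1"
    and S1: "P ** tau3_gen z Sigma1 = tau3_gen z Sigma1 ** P"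
    and S2: "P ** tau3_gen z Sigma2 = tau3_gen z Sigma2 ** P"
  shows "P = mat (P $ 1 $ 1)"
proof -
  have zero: "t = 0" if "t = z * t" for t
    using that z by simp
  have "(P ** tau3_gen z Sigma1) $ i $ j = (tau3_gen z Sigma1 ** P) $ i $ j"
    and "(P ** tau3_gen z Sigma2) $ i $ j = (tau3_gen z Sigma2 ** P) $ i $ j" for i j
    by (simp_all only: S1 S2)
  note entry = this[unfolded matrix_matrix_mult_def sum_3 tau3_gen_def, simplified]
  have diag: "P $ 2 $ 2 = P $ 1 $ 1" "P $ 3 $ 3 = P $ 2 $ 2"
    using entry(1)[of 2 1] entry(2)[of 3 2] by simp_all
  have eqs: "P $ 1 $ 3 = z * P $ 2 $ 3" "P $ 2 $ 3 = P $ 1 $ 3"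
    "P $ 3 $ 2 = z * P $ 3 $ 1" "P $ 3 $ 2 = P $ 3 $ 1"
    "P $ 1 $ 3 = P $ 1 $ 2" "P $ 3 $ 1 = P $ 2 $ 1"
    by (use entry(1)[of 1 3] in simp, use entry(1)[of 2 3] in simp,
        use entry(1)[of 3 2] in \<open>simp add: mult.commute\<close>, use entry(1)[of 3 1] in simp,
        use entry(2)[of 1 2] in simp, use entry(2)[of 3 1] in simp)
  have "P $ 1 $ 3 = 0" "P $ 3 $ 1 = 0"
    using zero eqs(1-4) by metis+
  then have "P $ 1 $ 2 = 0" "P $ 1 $ 3 = 0" "P $ 2 $ 1 = 0" "P $ 2 $ 3 = 0" "P $ 3 $ 1 = 0"
    "P $ 3 $ 2 = 0"
    using eqs by metis+
  then show ?thesis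
    using diag by (simp add: vec_eq_iff forall_3 mat_def)
qed

section \<open>Equivalence\<close>

lemma wb_elem_carrier [simp]: "wb_elem g \<in> carrier WB3"
  by (simp add: wb_elem_def WB3_def presented_group_carrier)

lemma matrix_inv_inverse:
  fixes A :: "'a::semiring_1 ^ 'n ^ 'm"
  assumes "invertible A"
  shows "A ** matrix_inv A = mat 1" "matrix_inv A ** A = mat 1"
  using someI_ex[OF assms[unfolded invertible_def]] by (simp_all add: matrix_inv_def)

lemma equivalent_reps_det:
  assumes "equivalent_reps G \<rho> \<rho>'" "g \<in> carrier G"
  shows "det (\<rho>' g) = det (\<rho> g)"
proof -
  obtain P where P: "invertible P" "\<rho>' g = P ** \<rho> g ** matrix_inv P"
    using assms by (auto simp: equivalent_reps_def)
  have "det P * det (matrix_inv P) = 1"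
    using matrix_inv_inverse(1)[OF P(1)] by (metis det_I det_mul)
  then show ?thesis by (simp add: P(2) det_mul algebra_simps)
qed

text \<open>The determinant of \<open>\<sigma>\<^sub>1\<close> is \<open>-z\<close>.\<close>

lemma equivalent_reps_tau3_parameter:
  assumes "equivalent_reps WB3 \<rho> \<rho>'"
    and "\<rho> (wb_elem Sigma1) = tau3_gen z Sigma1" "\<rho>' (wb_elem Sigma1) = tau3_gen z' Sigma1"
  shows "z = z'"
  using equivalent_reps_det[OF assms(1), of "wb_elem Sigma1"]
  by (simp add: assms(2,3) det_3 tau3_gen_def)

text \<open>An equivalence is an intertwiner of the braid generators, hence scalar, and conjugation by
  a scalar changes nothing.\<close>

lemma equivalent_reps_tau3_eq:
  assumes "equivalent_reps WB3 \<rho> \<rho>'" "z \<noteq> 1"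
    and \<rho>: "\<And>g. g \<in> {Sigma1, Sigma2} \<Longrightarrow> \<rho> (wb_elem g) = tau3_gen z g"
    and \<rho>': "\<And>g. g \<in> {Sigma1, Sigma2} \<Longrightarrow> \<rho>' (wb_elem g) = tau3_gen z g"
    and "h \<in> carrier WB3"
  shows "\<rho>' h = \<rho> h"
proof -
  obtain P where P: "invertible P"
    and conj: "\<And>g. g \<in> carrier WB3 \<Longrightarrow> \<rho>' g = P ** \<rho> g ** matrix_inv P"
    using assms(1) by (auto simp: equivalent_reps_def)
  have inter: "\<rho>' g ** P = P ** \<rho> g" if "g \<in> carrier WB3" for g
    using matrix_inv_inverse(2)[OF P] by (simp add: conj[OF that] flip: matrix_mul_assoc)
  have "P = mat (P $ 1 $ 1)"
    using inter[of "wb_elem Sigma1"] inter[of "wb_elem Sigma2"] assms(2)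
    by (intro tau3_commutant[of z]) (simp_all add: \<rho> \<rho>')
  then have "P ** \<rho> h = \<rho> h ** P" by (metis mat_mult_commute)
  then show ?thesis
    using matrix_inv_inverse(1)[OF P] by (simp add: conj[OF assms(5)] flip: matrix_mul_assoc)
qed

text \<open>The diagonal of the image of \<open>\<alpha>\<^sub>1\<close> consists of the coefficients, and these give \<open>l\<close> by the Fourier
  transform. Each coefficient also occurs multiplied by \<open>x\<close>, and as the coefficients add up to
  \<open>1\<close>, these entries add up to \<open>x\<close>. For \<open>c\<close> this entry is found in the image of \<open>\<alpha>\<^sub>2\<close> only.\<close>

lemma psi3_gen_inj:
  assumes "\<omega> ^ 3 = 1" "\<omega> \<noteq> 1"
    and A1: "psi3_gen \<omega> z l1 x1 Alpha1 = psi3_gen \<omega> z l2 x2 Alpha1"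
    and A2: "psi3_gen \<omega> z l1 x1 Alpha2 = psi3_gen \<omega> z l2 x2 Alpha2"
  shows "l1 = l2 \<and> x1 = x2"
proof -
  have "psi3_gen \<omega> z l1 x1 Alpha1 $ i $ j = psi3_gen \<omega> z l2 x2 Alpha1 $ i $ j"
    and "psi3_gen \<omega> z l1 x1 Alpha2 $ i $ j = psi3_gen \<omega> z l2 x2 Alpha2 $ i $ j" for i j
    by (simp_all only: A1 A2)
  note entry = this[unfolded psi3_gen_Alpha[OF assms(1)] psi3_alpha_def]
  have eqs: "psi3_coeff \<omega> l1 = psi3_coeff \<omega> l2" "psi3_coeff 1 l1 = psi3_coeff 1 l2"
    "psi3_coeff (\<omega>\<^sup>2) l1 = psi3_coeff (\<omega>\<^sup>2) l2"
    "x1 * psi3_coeff \<omega> l1 = x2 * psi3_coeff \<omega> l2" "x1 * psi3_coeff 1 l1 = x2 * psi3_coeff 1 l2"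
    "x1 * psi3_coeff (\<omega>\<^sup>2) l1 = x2 * psi3_coeff (\<omega>\<^sup>2) l2"
    by (use entry(1)[of 1 1] in simp, use entry(1)[of 3 3] in simp,
        use entry(1)[of 2 2] in simp, use entry(1)[of 3 2] in simp,
        use entry(1)[of 2 1] in simp, use entry(2)[of 2 1] in simp)
  have "psi3_coeff 1 l1 + \<omega>\<^sup>2 * psi3_coeff \<omega> l1 + \<omega> * psi3_coeff (\<omega>\<^sup>2) l1
    = psi3_coeff 1 l2 + \<omega>\<^sup>2 * psi3_coeff \<omega> l2 + \<omega> * psi3_coeff (\<omega>\<^sup>2) l2"
    by (simp only: eqs(1-3))
  then have "l1 = l2"
    by (simp only: psi3_coeff_recover[OF assms(1,2)])
  moreover have "x1 * (psi3_coeff \<omega> l1 + psi3_coeff 1 l1 + psi3_coeff (\<omega>\<^sup>2) l1)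
    = x2 * (psi3_coeff \<omega> l2 + psi3_coeff 1 l2 + psi3_coeff (\<omega>\<^sup>2) l2)"
    by (simp only: distrib_left eqs(4-6))
  then have "x1 = x2"
    by (simp only: psi3_coeff_sum[OF assms(1,2)] mult_1_right)
  ultimately show ?thesis ..
qed

text \<open>For \<open>l = 1\<close> the Fourier transform is constant, so \<open>b = 1\<close> and \<open>a = c = 0\<close>.\<close>

lemma psi3_gen_one:
  assumes "\<omega> ^ 3 = 1" "\<omega> \<noteq> 1"
  shows "psi3_gen \<omega> z 1 x = tau3_tilde_gen z x"
proof (rule ext)
  fix g
  have "psi3_coeff \<omega> 1 = 0" "psi3_coeff 1 1 = 1" "psi3_coeff (\<omega>\<^sup>2) 1 = 0"
    using psi3_coeff_scaled[OF assms(1), of 1] primitive_cube_root_sum[OF assms]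
    by (simp_all add: algebra_simps)
  then show "psi3_gen \<omega> z 1 x g = tau3_tilde_gen z x g"
    by (cases g) (simp_all add: psi3_gen_Alpha[OF assms(1)] psi3_alpha_def tau3_tilde_gen_def)
qed

lemma psi3_gen_eq_tau3_tilde_gen:
  assumes "\<omega> ^ 3 = 1" "\<omega> \<noteq> 1"
    and "psi3_gen \<omega> z l x Alpha1 = tau3_tilde_gen z l' Alpha1"
  shows "l = 1"
proof -
  have "psi3_coeff \<omega> l = 0" "psi3_coeff 1 l = 1" "psi3_coeff (\<omega>\<^sup>2) l = 0"
    using assms(3)
    by (simp_all add: psi3_gen_Alpha[OF assms(1)] psi3_alpha_def tau3_tilde_gen_def
        vec_eq_iff forall_3)
  then show ?thesis using psi3_coeff_recover[OF assms(1,2), of l] by simp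
qed

theorem lemma5p3:
  fixes \<omega> :: complex
  assumes "\<omega> ^ 3 = 1" and "\<omega> \<noteq> 1"
  shows
   "(\<forall>z l x. z \<noteq> 0 \<and> l \<noteq> 0 \<and> x \<noteq> 0 \<and> x ^ 3 = 1 / z\<^sup>2 \<longrightarrow>
       is_rep WB3 (psi3 \<omega> z l x)
     \<and> (\<forall>g. psi3 \<omega> z l x (wb_elem g) = psi3_gen \<omega> z l x g)
     \<and> (\<forall>h\<in>B3. psi3 \<omega> z l x h = tau3 z h)
     \<and> (z \<noteq> 1 \<longrightarrow> irreducible_rep WB3 (psi3 \<omega> z l x)))
    \<and>
    (\<forall>z1 z2 l1 l2 x1 x2. z1 \<noteq> 0 \<and> z2 \<noteq> 0 \<and> l1 \<noteq> 0 \<and> l2 \<noteq> 0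
        \<and> x1 ^ 3 = 1 / z1\<^sup>2 \<and> x2 ^ 3 = 1 / z2\<^sup>2 \<longrightarrow>
       (z1 \<noteq> z2 \<longrightarrow> \<not> equivalent_reps WB3 (psi3 \<omega> z1 l1 x1) (psi3 \<omega> z2 l2 x2))
     \<and> (\<forall>z. z1 = z \<and> z2 = z \<and> z \<noteq> 1 \<and> (l1, x1) \<noteq> (l2, x2) \<longrightarrow>
          \<not> equivalent_reps WB3 (psi3 \<omega> z l1 x1) (psi3 \<omega> z l2 x2)))
    \<and>
    (\<forall>z1 z2 l1 l2 x1. z1 \<noteq> 0 \<and> z2 \<noteq> 0 \<and> l1 \<noteq> 0 \<and> l2 \<noteq> 0 \<and> x1 ^ 3 = 1 / z1\<^sup>2 \<longrightarrow>
       (z1 \<noteq> z2 \<longrightarrow> \<not> equivalent_reps WB3 (psi3 \<omega> z1 l1 x1) (tau3_tilde z2 l2))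
     \<and> (\<forall>z. z1 = z \<and> z2 = z \<and> z \<noteq> 1 \<and> l1 \<noteq> 1 \<longrightarrow>
          \<not> equivalent_reps WB3 (psi3 \<omega> z l1 x1) (tau3_tilde z l2)))
    \<and>
    (\<forall>z x. z \<noteq> 0 \<and> x ^ 3 = 1 / z\<^sup>2 \<longrightarrow>
       (\<forall>g\<in>carrier WB3. psi3 \<omega> z 1 x g = tau3_tilde z x g))"
proof (intro conjI allI impI ballI; (elim conjE)?)
  note \<omega> = assms
  {
    fix z l x :: complex
    assume z: "z \<noteq> 0" "l \<noteq> 0" "x ^ 3 = 1 / z\<^sup>2"
    show rep: "is_rep WB3 (psi3 \<omega> z l x)"
      by (rule psi3_is_rep[OF \<omega> z])
    show elem: "psi3 \<omega> z l x (wb_elem g) = psi3_gen \<omega> z l x g" for g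
      by (rule psi3_elem[OF \<omega> z])
    show "psi3 \<omega> z l x h = tau3 z h" if "h \<in> B3" for h
      by (rule psi3_extends_tau3[OF \<omega> z that])
    show "irreducible_rep WB3 (psi3 \<omega> z l x)" if "z \<noteq> 1"
      unfolding irreducible_rep_def
    proof (intro conjI rep allI impI; elim conjE)
      fix W :: "(complex ^ 3) set"
      assume W: "vec.subspace W" and inv: "\<forall>g\<in>carrier WB3. \<forall>v\<in>W. psi3 \<omega> z l x g *v v \<in> W"
      have "psi3_gen \<omega> z l x g *v v \<in> W" if "v \<in> W" for g v
        using inv that wb_elem_carrier elem by metis
      from this[of _ Sigma1] this[of _ Sigma2] show "W = {0} \<or> W = UNIV"
        by (intro tau3_invariant_subspace[OF W z(1) that]) simp_all
    qed
  }
  {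
    fix z1 z2 l1 l2 x1 x2 :: complex
    assume z: "z1 \<noteq> 0" "z2 \<noteq> 0" "l1 \<noteq> 0" "l2 \<noteq> 0" "x1 ^ 3 = 1 / z1\<^sup>2" "x2 ^ 3 = 1 / z2\<^sup>2"
    note elem = psi3_elem[OF \<omega> z(1,3,5)] psi3_elem[OF \<omega> z(2,4,6)]
    show "\<not> equivalent_reps WB3 (psi3 \<omega> z1 l1 x1) (psi3 \<omega> z2 l2 x2)" if "z1 \<noteq> z2"
      using equivalent_reps_tau3_parameter[of "psi3 \<omega> z1 l1 x1" "psi3 \<omega> z2 l2 x2" z1 z2] that
      by (auto simp: elem)
    fix z assume eq: "z1 = z" "z2 = z" and neq: "z \<noteq> 1" "(l1, x1) \<noteq> (l2, x2)"
    show "\<not> equivalent_reps WB3 (psi3 \<omega> z l1 x1) (psi3 \<omega> z l2 x2)"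
    proof
      assume equiv: "equivalent_reps WB3 (psi3 \<omega> z l1 x1) (psi3 \<omega> z l2 x2)"
      have "psi3 \<omega> z l2 x2 (wb_elem g) = psi3 \<omega> z l1 x1 (wb_elem g)" for g
        by (rule equivalent_reps_tau3_eq[OF equiv neq(1) _ _ wb_elem_carrier])
          (use elem eq in auto)
      then have "psi3_gen \<omega> z l2 x2 g = psi3_gen \<omega> z l1 x1 g" for g
        using elem eq by simp
      then show False using psi3_gen_inj[OF \<omega>, of z l1 x1 l2 x2] neq(2) by simp
    qed
  }
  {
    fix z1 z2 l1 l2 x1 :: complex
    assume z: "z1 \<noteq> 0" "z2 \<noteq> 0" "l1 \<noteq> 0" "l2 \<noteq> 0" "x1 ^ 3 = 1 / z1\<^sup>2"
    note elem = psi3_elem[OF \<omega> z(1,3,5)] tau3_tilde_elem[OF z(2,4)]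
    have sigma: "tau3_tilde_gen z l g = tau3_gen z g" if "g \<in> {Sigma1, Sigma2}" for z l g
      using that by (auto simp: tau3_tilde_gen_def)
    show "\<not> equivalent_reps WB3 (psi3 \<omega> z1 l1 x1) (tau3_tilde z2 l2)" if "z1 \<noteq> z2"
      using equivalent_reps_tau3_parameter[of "psi3 \<omega> z1 l1 x1" "tau3_tilde z2 l2" z1 z2] that
      by (auto simp: elem sigma)
    fix z assume eq: "z1 = z" "z2 = z" and neq: "z \<noteq> 1" "l1 \<noteq> 1"
    show "\<not> equivalent_reps WB3 (psi3 \<omega> z l1 x1) (tau3_tilde z l2)"
    proof
      assume equiv: "equivalent_reps WB3 (psi3 \<omega> z l1 x1) (tau3_tilde z l2)"
      have "tau3_tilde z l2 (wb_elem g) = psi3 \<omega> z l1 x1 (wb_elem g)" for g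
        by (rule equivalent_reps_tau3_eq[OF equiv neq(1) _ _ wb_elem_carrier])
          (use elem eq sigma in auto)
      then have "tau3_tilde_gen z l2 g = psi3_gen \<omega> z l1 x1 g" for g
        using elem eq by simp
      then show False using psi3_gen_eq_tau3_tilde_gen[OF \<omega>, of z l1 x1 l2] neq(2) by simp
    qed
  }
  show "psi3 \<omega> z 1 x g = tau3_tilde z x g" for z x g
    by (simp add: psi3_def tau3_tilde_def psi3_gen_one[OF \<omega>])
qed

end
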